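(* Let $A,B,H,K$ be any logically independent events. The probability assessment $\mathcal{P}=(x,y,z)$ on the family of conditional events $\mathcal{F}=\{A|H,\ B|K,\ (B|K)|_{C}(A|H)\}$ is coherent for every $(x,y,z)\in[0,1]^3$.
   Context: Events are two-valued entities (true/false), identified with their indicators (values $1/0$). $\emptyset$ is the impossible event; $AB$ denotes $A\wedge B$; $\overline{A}$ is the negation of $A$. Four events are logically independent if all $16$ conjunctions obtained by taking each event or its negation are different from $\emptyset$. For events $E,H$ with $H\neq\emptyset$, the conditional event $E|H$ is true if $EH$ is true, false if $\overline{E}H$ is true, void if $\overline{H}$ is true. Coherence: a real vector $\mathcal{P}=(p_1,\dots,p_n)$, with $p_j=P(E_j|H_j)$, on $\mathcal{F}=\{E_1|H_1,\dots,E_n|H_n\}$ is coherent iff for every nonempty $J\subseteq\{1,\dots,n\}$ and all real numbers $s_j$ ($j\in J$), the random gain $G=\sum_{j\in J}s_jH_j(E_j-p_j)$, restricted to the cases where $\bigvee_{j\in J}H_j$ is true, satisfies $\min G\le 0\le\max G$. Cooper–Calabrese iterated conditional: $(B|K)|_{C}(A|H)=B|(K\wedge(\overline{H}\vee A))$ (a conditional event). *)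

theory Defs
  imports Complex_Main "HOL-Library.Indicator_Function"
begin

text \<open>Events are sets of elementary cases, i.e. elements of an arbitrary type \<open>'w\<close>:
  conjunction is \<open>\<inter>\<close>, disjunction is \<open>\<union>\<close>, negation is \<open>-\<close>,
  the impossible event is \<open>{}\<close>, and \<open>indicator E w\<close> is the value of \<open>E\<close> in case \<open>w\<close>.\<close>

definition literal :: "bool \<Rightarrow> 'w set \<Rightarrow> 'w set" where
  "literal b E = (if b then E else - E)"

definition logically_independent4 ::
    "'w set \<Rightarrow> 'w set \<Rightarrow> 'w set \<Rightarrow> 'w set \<Rightarrow> bool" where
  "logically_independent4 A B H K \<longleftrightarrow>
     (\<forall>a b h k. literal a A \<inter> literal b B \<inter> literal h H \<inter> literal k K \<noteq> {})"

text \<open>\<open>Cond E H\<close> stands for \<open>E|H\<close>: true on \<open>E \<inter> H\<close>, false on \<open>- E \<inter> H\<close>, void on \<open>- H\<close>.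
  The requirement \<open>H \<noteq> {}\<close> is not built into the type; it is imposed on the members of the
  family in the definition of coherence.\<close>

datatype 'w cond_event = Cond (event: "'w set") (given: "'w set")

definition cooper_calabrese :: "'w cond_event \<Rightarrow> 'w cond_event \<Rightarrow> 'w cond_event" where
  "cooper_calabrese BK AH = Cond (event BK) (given BK \<inter> (- given AH \<union> event AH))"

definition gain ::
    "'w cond_event list \<Rightarrow> real list \<Rightarrow> nat set \<Rightarrow> (nat \<Rightarrow> real) \<Rightarrow> 'w \<Rightarrow> real" where
  "gain F P J s w =
     (\<Sum>j\<in>J. s j * indicator (given (F ! j)) w * (indicator (event (F ! j)) w - P ! j))"

text \<open>In \<open>coherent\<close>, \<open>J\<close> is a nonempty subset of a finite set and \<open>gain\<close> depends on \<open>w\<close> only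
  through finitely many indicators, so \<open>Min\<close> and \<open>Max\<close> are taken over a finite set, which is
  nonempty because all conditioning events are.\<close>

definition coherent :: "'w cond_event list \<Rightarrow> real list \<Rightarrow> bool" where
  "coherent F P \<longleftrightarrow>
     length P = length F \<and>
     (\<forall>C\<in>set F. given C \<noteq> {}) \<and>
     (\<forall>J s. J \<subseteq> {..<length F} \<longrightarrow> J \<noteq> {} \<longrightarrow>
        (let G = gain F P J s ` (\<Union>j\<in>J. given (F ! j))
         in Min G \<le> 0 \<and> 0 \<le> Max G))"

end

theory Submission imports Defs begin

text \<open>Why all of \<open>[0,1]\<^sup>3\<close> is coherent: for each of the three conditional events there are cases
  that make it true, and cases that make it false, in which every conditional event listed after it
  is void.  For \<open>A|H\<close> such cases lie in \<open>H \<inter> - K\<close>, where \<open>K\<close> fails and with it both later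
  conditioning events.  For \<open>B|K\<close> they lie in \<open>- A \<inter> H \<inter> K\<close>, where \<open>- H \<union> A\<close> fails.  The last
  conditional event has no successor, so any case in its conditioning event will do.

  Such a triangular family can never produce a sure loss or a sure win
  (lemma \<open>coherent_if_triangular\<close>): whatever the nonempty set \<open>J\<close> of bets, its least index \<open>j\<close> can
  be settled while all the other bets are called off.  The gain is then the single term
  \<open>s j * (b - P ! j)\<close>, whose truth value \<open>b\<close> is free; as \<open>P ! j\<close> lies between the two possible
  values of \<open>b\<close>, one choice of \<open>b\<close> makes the term nonpositive and the other makes it nonnegative.\<close>

text \<open>The gain only sees which of the finitely many events contain the case, so it takes finitely
  many values even when there are infinitely many cases.  This makes \<open>Min\<close> and \<open>Max\<close> in the
  definition of coherence meaningful.\<close>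

lemma finite_range_gain:
  assumes "finite J"
  shows "finite (gain F P J s ` W)"
proof -
  define g where "g = (\<lambda>(S, T). \<Sum>j\<in>J. s j * of_bool (j \<in> S) * (of_bool (j \<in> T) - P ! j))"
  have "gain F P J s w = g ({j\<in>J. w \<in> given (F ! j)}, {j\<in>J. w \<in> event (F ! j)})" for w
    unfolding gain_def g_def by (auto simp: indicator_def intro!: sum.cong)
  then have "gain F P J s ` W \<subseteq> g ` (Pow J \<times> Pow J)"
    by auto
  then show ?thesis
    using assms by (meson finite_Pow_iff finite_SigmaI finite_imageI finite_subset)
qed

lemma gain_if_only_one_active:
  assumes "finite J" "j \<in> J" "w \<in> given (F ! j)"
    and "\<And>i. i \<in> J \<Longrightarrow> i \<noteq> j \<Longrightarrow> w \<notin> given (F ! i)"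
  shows "gain F P J s w = s j * (indicator (event (F ! j)) w - P ! j)"
proof -
  have "gain F P J s w = s j * indicator (given (F ! j)) w * (indicator (event (F ! j)) w - P ! j)"
    unfolding gain_def using assms(1,2,4) by (subst sum.remove[of J j]) auto
  then show ?thesis
    using assms(3) by simp
qed

text \<open>The hypothesis is an elimination order for the bets: the earlier of two conditional events
  can be settled either way with the later one void, so the least index in a set of bets decides
  the sign of the gain on its own.\<close>

lemma coherent_if_triangular:
  assumes len: "length P = length F"
    and prob: "\<And>j. j < length F \<Longrightarrow> P ! j \<in> {0..1}"
    and settle: "\<And>j b. j < length F \<Longrightarrow>
      \<exists>w \<in> given (F ! j). (w \<in> event (F ! j) \<longleftrightarrow> b) \<and>
        (\<forall>i. j < i \<longrightarrow> i < length F \<longrightarrow> w \<notin> given (F ! i))"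
  shows "coherent F P"
  unfolding coherent_def
proof (intro conjI allI impI)
  show "\<forall>C\<in>set F. given C \<noteq> {}"
    using settle by (metis empty_iff in_set_conv_nth)
next
  fix J :: "nat set" and s :: "nat \<Rightarrow> real"
  assume J: "J \<subseteq> {..<length F}" "J \<noteq> {}"
  define W where "W = (\<Union>j\<in>J. given (F ! j))"
  define j where "j = Min J"
  have fin: "finite J"
    using J(1) finite_subset by blast
  have jJ: "j \<in> J" and least: "\<And>i. i \<in> J \<Longrightarrow> j \<le> i"
    using fin J(2) by (simp_all add: j_def)
  have jF: "j < length F"
    using J(1) jJ by auto
  have single_bet: "\<exists>w\<in>W. gain F P J s w = s j * (of_bool b - P ! j)" for b
  proof -
    obtain w where w: "w \<in> given (F ! j)" "w \<in> event (F ! j) \<longleftrightarrow> b"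
      and void: "\<And>i. j < i \<Longrightarrow> i < length F \<Longrightarrow> w \<notin> given (F ! i)"
      using settle[OF jF, of b] by blast
    have "gain F P J s w = s j * (indicator (event (F ! j)) w - P ! j)"
    proof (rule gain_if_only_one_active[OF fin jJ w(1)])
      fix i assume "i \<in> J" "i \<noteq> j"
      then show "w \<notin> given (F ! i)"
        using void[of i] least[of i] J(1) by auto
    qed
    then show ?thesis
      using w jJ by (intro bexI[of _ w]) (auto simp: W_def indicator_def)
  qed
  have p: "0 \<le> P ! j" "P ! j \<le> 1"
    using prob[OF jF] by auto
  \<comment> \<open>The gain is nonpositive when the event \<open>j\<close> turns out against the sign of the stake.\<close>
  have "s j * (of_bool (s j < 0) - P ! j) \<le> 0" "0 \<le> s j * (of_bool (s j \<ge> 0) - P ! j)"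
    using p by (auto simp: mult_le_0_iff zero_le_mult_iff)
  then obtain v w where "v \<in> W" "gain F P J s v \<le> 0" and "w \<in> W" "0 \<le> gain F P J s w"
    using single_bet by metis
  then have "Min (gain F P J s ` W) \<le> 0" "0 \<le> Max (gain F P J s ` W)"
    using finite_range_gain[OF fin, of F P s W] by (meson Min_le Max_ge imageI order_trans)+
  then show "let G = gain F P J s ` (\<Union>j\<in>J. given (F ! j)) in Min G \<le> 0 \<and> 0 \<le> Max G"
    by (simp add: W_def Let_def)
qed (rule len)

lemma logically_independent4_case:
  assumes "logically_independent4 A B H K"
  obtains w where "w \<in> A \<longleftrightarrow> a" "w \<in> B \<longleftrightarrow> b" "w \<in> H \<longleftrightarrow> h" "w \<in> K \<longleftrightarrow> k"
proof -
  have "literal a A \<inter> literal b B \<inter> literal h H \<inter> literal k K \<noteq> {}"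
    using assms by (simp add: logically_independent4_def)
  then obtain w where "w \<in> literal a A \<inter> literal b B \<inter> literal h H \<inter> literal k K"
    by blast
  then show ?thesis
    by (intro that[of w]) (auto simp: literal_def split: if_splits)
qed

theorem theorem5:
  fixes A B H K :: "'w set" and x y z :: real
  assumes "logically_independent4 A B H K"
    and "x \<in> {0..1}" and "y \<in> {0..1}" and "z \<in> {0..1}"
  shows "coherent [Cond A H, Cond B K, cooper_calabrese (Cond B K) (Cond A H)] [x, y, z]"
    (is "coherent ?F ?P")
proof (rule coherent_if_triangular)
  show "?P ! j \<in> {0..1}" if "j < length ?F" for j
    using that assms(2-4) by (auto simp: less_Suc_eq)
next
  fix j b assume "j < length ?F"
  then consider "j = 0" | "j = 1" | "j = 2"
    by fastforce
  then show "\<exists>w \<in> given (?F ! j). (w \<in> event (?F ! j) \<longleftrightarrow> b) \<and>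
      (\<forall>i. j < i \<longrightarrow> i < length ?F \<longrightarrow> w \<notin> given (?F ! i))"
  proof cases
    case 1
    \<comment> \<open>Outside \<open>K\<close> both conditional events on \<open>B\<close> are void.\<close>
    obtain w where "w \<in> A \<longleftrightarrow> b" "w \<in> B \<longleftrightarrow> True" "w \<in> H \<longleftrightarrow> True" "w \<in> K \<longleftrightarrow> False"
      by (rule logically_independent4_case[OF assms(1)])
    then show ?thesis
      using 1 by (auto simp: cooper_calabrese_def less_Suc_eq intro!: bexI[of _ w])
  next
    case 2
    \<comment> \<open>A false \<open>A|H\<close> voids the iterated conditional but leaves \<open>B|K\<close> undecided.\<close>
    obtain w where "w \<in> A \<longleftrightarrow> False" "w \<in> B \<longleftrightarrow> b" "w \<in> H \<longleftrightarrow> True" "w \<in> K \<longleftrightarrow> True"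
      by (rule logically_independent4_case[OF assms(1)])
    then show ?thesis
      using 2 by (auto simp: cooper_calabrese_def less_Suc_eq intro!: bexI[of _ w])
  next
    case 3
    obtain w where "w \<in> A \<longleftrightarrow> True" "w \<in> B \<longleftrightarrow> b" "w \<in> H \<longleftrightarrow> True" "w \<in> K \<longleftrightarrow> True"
      by (rule logically_independent4_case[OF assms(1)])
    then show ?thesis
      using 3 by (auto simp: cooper_calabrese_def less_Suc_eq intro!: bexI[of _ w])
  qed
qed simp

end
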